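(* Let $R$ be a ring, let $M$ be a g-radical supplemented left $R$-module, let $N$ be a left $R$-module and let $f : M \to N$ be an $R$-module homomorphism. Then the homomorphic image $f(M)$ is g-radical supplemented.
   Context: All rings are associative with identity and all modules are unital left modules. $N \le M$ means $N$ is a submodule of $M$. A submodule $N \le M$ is essential if $K \cap N \ne 0$ for every nonzero submodule $K$ of $M$. The generalized radical $Rad_g M$ of a module $M$ is the intersection of all maximal submodules of $M$ that are essential in $M$; if $M$ has no such submodule, $Rad_g M = M$. For $U, V \le M$, $V$ is a g-radical supplement of $U$ in $M$ if $M = U + V$ and $U \cap V \le Rad_g V$. The module $M$ is g-radical supplemented if every submodule of $M$ has a g-radical supplement in $M$. *)

theory Defs
  imports "HOL-Algebra.Module" "HOL-Algebra.AbelCoset"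
begin

text \<open>
  The library's locale \<^locale>\<open>module\<close> requires a commutative ring of scalars. Its record type and
  its locale \<^locale>\<open>submodule\<close> do not, and are used here unchanged.
\<close>

locale left_module = R?: ring R + M?: abelian_group M for R (structure) and M (structure) +
  assumes smult_closed [simp, intro]:
      "\<lbrakk>a \<in> carrier R; x \<in> carrier M\<rbrakk> \<Longrightarrow> a \<odot>\<^bsub>M\<^esub> x \<in> carrier M"
    and smult_l_distr:
      "\<lbrakk>a \<in> carrier R; b \<in> carrier R; x \<in> carrier M\<rbrakk> \<Longrightarrow>
       (a \<oplus> b) \<odot>\<^bsub>M\<^esub> x = a \<odot>\<^bsub>M\<^esub> x \<oplus>\<^bsub>M\<^esub> b \<odot>\<^bsub>M\<^esub> x"
    and smult_r_distr:
      "\<lbrakk>a \<in> carrier R; x \<in> carrier M; y \<in> carrier M\<rbrakk> \<Longrightarrow>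
       a \<odot>\<^bsub>M\<^esub> (x \<oplus>\<^bsub>M\<^esub> y) = a \<odot>\<^bsub>M\<^esub> x \<oplus>\<^bsub>M\<^esub> a \<odot>\<^bsub>M\<^esub> y"
    and smult_assoc:
      "\<lbrakk>a \<in> carrier R; b \<in> carrier R; x \<in> carrier M\<rbrakk> \<Longrightarrow>
       (a \<otimes> b) \<odot>\<^bsub>M\<^esub> x = a \<odot>\<^bsub>M\<^esub> (b \<odot>\<^bsub>M\<^esub> x)"
    and smult_one [simp]:
      "x \<in> carrier M \<Longrightarrow> \<one> \<odot>\<^bsub>M\<^esub> x = x"

definition left_module_hom ::
  "('r, 'k) ring_scheme \<Rightarrow> ('r, 'a, 'm) module_scheme \<Rightarrow> ('r, 'b, 'n) module_scheme \<Rightarrow> ('a \<Rightarrow> 'b) set"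
  where "left_module_hom R M N =
    {f \<in> hom (add_monoid M) (add_monoid N).
       \<forall>a\<in>carrier R. \<forall>x\<in>carrier M. f (a \<odot>\<^bsub>M\<^esub> x) = a \<odot>\<^bsub>N\<^esub> f x}"

definition essential_submodule ::
  "'a set \<Rightarrow> ('r, 'k) ring_scheme \<Rightarrow> ('r, 'a, 'm) module_scheme \<Rightarrow> bool"
  where "essential_submodule N R M \<longleftrightarrow>
    submodule N R M \<and> (\<forall>K. submodule K R M \<and> K \<noteq> {\<zero>\<^bsub>M\<^esub>} \<longrightarrow> K \<inter> N \<noteq> {\<zero>\<^bsub>M\<^esub>})"

definition maximal_submodule ::
  "'a set \<Rightarrow> ('r, 'k) ring_scheme \<Rightarrow> ('r, 'a, 'm) module_scheme \<Rightarrow> bool"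
  where "maximal_submodule N R M \<longleftrightarrow>
    submodule N R M \<and> N \<noteq> carrier M \<and>
    (\<forall>K. submodule K R M \<and> N \<subseteq> K \<longrightarrow> K = N \<or> K = carrier M)"

definition Rad_g :: "('r, 'k) ring_scheme \<Rightarrow> ('r, 'a, 'm) module_scheme \<Rightarrow> 'a set"
  where "Rad_g R M =
    (if \<exists>N. maximal_submodule N R M \<and> essential_submodule N R M
     then \<Inter>{N. maximal_submodule N R M \<and> essential_submodule N R M}
     else carrier M)"

text \<open>A submodule \<open>V\<close> regarded as a module in its own right is \<open>M\<lparr>carrier := V\<rparr>\<close>.\<close>

definition g_radical_supplement ::
  "'a set \<Rightarrow> 'a set \<Rightarrow> ('r, 'k) ring_scheme \<Rightarrow> ('r, 'a, 'm) module_scheme \<Rightarrow> bool"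
  where "g_radical_supplement V U R M \<longleftrightarrow>
    submodule U R M \<and> submodule V R M \<and>
    carrier M = U <+>\<^bsub>M\<^esub> V \<and> U \<inter> V \<subseteq> Rad_g R (M\<lparr>carrier := V\<rparr>)"

definition g_radical_supplemented ::
  "('r, 'k) ring_scheme \<Rightarrow> ('r, 'a, 'm) module_scheme \<Rightarrow> bool"
  where "g_radical_supplemented R M \<longleftrightarrow>
    (\<forall>U. submodule U R M \<longrightarrow> (\<exists>V. g_radical_supplement V U R M))"

lemma (in left_module) submodule_is_left_module:
  assumes "submodule H R M"
  shows "left_module R (M\<lparr>carrier := H\<rparr>)"
proof -
  interpret H: submodule H R M by fact
  have sub: "\<And>x. x \<in> H \<Longrightarrow> x \<in> carrier M"
    using H.subset by auto
  have "group ((add_monoid M)\<lparr>carrier := H\<rparr>)"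
    by (rule subgroup.subgroup_is_group [OF H.subgroup_axioms M.a_group])
  moreover have "comm_monoid ((add_monoid M)\<lparr>carrier := H\<rparr>)"
    by (rule comm_monoid.submonoid_is_comm_monoid
        [OF M.a_comm_monoid H.subgroup_is_submonoid])
  ultimately have "abelian_group (M\<lparr>carrier := H\<rparr>)"
    by (auto intro!: abelian_group.intro abelian_monoid.intro abelian_group_axioms.intro
        comm_group.intro)
  moreover have "left_module_axioms R (M\<lparr>carrier := H\<rparr>)"
    using sub by unfold_locales (auto simp: smult_l_distr smult_r_distr smult_assoc)
  ultimately show ?thesis
    by (intro left_module.intro R.ring_axioms)
qed

lemma image_submodule:
  assumes "left_module R M" "left_module R N" "f \<in> left_module_hom R M N"
  shows "submodule (f ` carrier M) R N"
proof -
  interpret M: left_module R M by fact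
  interpret N: left_module R N by fact
  have "group_hom (add_monoid M) (add_monoid N) f"
    using assms(3) M.a_group N.a_group
    by (auto simp: left_module_hom_def group_hom_def group_hom_axioms_def)
  then have "subgroup (f ` carrier M) (add_monoid N)"
    using group_hom.img_is_subgroup by fastforce
  moreover have "submodule_axioms (f ` carrier M) R N"
  proof
    fix a y assume "a \<in> carrier R" "y \<in> f ` carrier M"
    then obtain x where x: "x \<in> carrier M" "y = f x" by auto
    then have "a \<odot>\<^bsub>N\<^esub> y = f (a \<odot>\<^bsub>M\<^esub> x)"
      using assms(3) \<open>a \<in> carrier R\<close> by (simp add: left_module_hom_def)
    then show "a \<odot>\<^bsub>N\<^esub> y \<in> f ` carrier M"
      using x \<open>a \<in> carrier R\<close> by auto
  qed
  ultimately show ?thesis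
    by (rule submodule.intro)
qed

end

theory Submission
  imports Defs
begin

text \<open>
  A surjective homomorphism \<open>f\<close> pulls maximal submodules back to maximal ones and essential
  submodules back to essential ones, so it maps the generalized radical into the generalized radical.
  Hence if \<open>V\<close> is a g-radical supplement of the preimage of \<open>U\<close>, then \<open>f ` V\<close> is one of \<open>U\<close>.
\<close>

lemma (in left_module) submoduleI:
  assumes "H \<subseteq> carrier M" "\<zero>\<^bsub>M\<^esub> \<in> H"
    and "\<And>x y. \<lbrakk>x \<in> H; y \<in> H\<rbrakk> \<Longrightarrow> x \<oplus>\<^bsub>M\<^esub> y \<in> H"
    and "\<And>x. x \<in> H \<Longrightarrow> \<ominus>\<^bsub>M\<^esub> x \<in> H"
    and "\<And>a x. \<lbrakk>a \<in> carrier R; x \<in> H\<rbrakk> \<Longrightarrow> a \<odot>\<^bsub>M\<^esub> x \<in> H"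
  shows "submodule H R M"
  using assms
  by (auto intro!: submodule.intro subgroup.intro submodule_axioms.intro simp flip: a_inv_def)

lemma submoduleD:
  assumes "submodule H R M"
  shows "H \<subseteq> carrier M" "\<zero>\<^bsub>M\<^esub> \<in> H"
    and "\<And>x y. \<lbrakk>x \<in> H; y \<in> H\<rbrakk> \<Longrightarrow> x \<oplus>\<^bsub>M\<^esub> y \<in> H"
    and "\<And>x. x \<in> H \<Longrightarrow> \<ominus>\<^bsub>M\<^esub> x \<in> H"
    and "\<And>a x. \<lbrakk>a \<in> carrier R; x \<in> H\<rbrakk> \<Longrightarrow> a \<odot>\<^bsub>M\<^esub> x \<in> H"
  using assms
  by (auto simp: submodule_def subgroup_def submodule_axioms_def a_inv_def)

text \<open>Both laws are equations between elements, so they survive a smaller source and any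
  target carrier that still holds the values. This makes \<open>f\<close> surjective and restricts
  it to a submodule.\<close>

lemma left_module_hom_restrict:
  assumes "f \<in> left_module_hom R M N" "H \<subseteq> carrier M" "f ` H \<subseteq> K"
  shows "f \<in> left_module_hom R (M\<lparr>carrier := H\<rparr>) (N\<lparr>carrier := K\<rparr>)"
  using assms by (auto simp: left_module_hom_def hom_def subset_iff)

text \<open>A locale, because the argument is instantiated twice: for a homomorphism onto its image,
  and for its restriction to a supplement \<open>V\<close>, onto the image of
  \<open>V\<close>.\<close>

locale left_module_epi = M: left_module R M + N: left_module R N
  for R (structure) and M (structure) and N (structure) +
  fixes f
  assumes hom: "f \<in> left_module_hom R M N"
    and surj: "f ` carrier M = carrier N"
begin

sublocale abelian_group_hom M N f
  using hom M.a_group N.a_group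
  by (intro abelian_group_homI M.abelian_group_axioms N.abelian_group_axioms)
    (auto simp: left_module_hom_def group_hom_def group_hom_axioms_def)

lemma hom_smult: "\<lbrakk>a \<in> carrier R; x \<in> carrier M\<rbrakk> \<Longrightarrow> f (a \<odot>\<^bsub>M\<^esub> x) = a \<odot>\<^bsub>N\<^esub> f x"
  using hom by (simp add: left_module_hom_def)

lemma submodule_image:
  assumes "submodule H R M"
  shows "submodule (f ` H) R N"
proof -
  \<comment> \<open>The update of \<open>N\<close> is trivial; it only gives the target the shape
    that the restriction lemma expects.\<close>
  have "f \<in> left_module_hom R (M\<lparr>carrier := H\<rparr>) (N\<lparr>carrier := carrier N\<rparr>)"
    using submoduleD(1)[OF assms] by (intro left_module_hom_restrict[OF hom]) auto
  then show ?thesis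
    using image_submodule[OF M.submodule_is_left_module[OF assms] N.left_module_axioms, of f]
    by simp
qed

lemma submodule_preimage:
  assumes "submodule K R N"
  shows "submodule {x \<in> carrier M. f x \<in> K} R M"
  using submoduleD[OF assms] by (intro M.submoduleI) (auto simp: hom_smult)

lemma image_preimage:
  assumes "K \<subseteq> carrier N"
  shows "f ` {x \<in> carrier M. f x \<in> K} = K"
  using assms surj by auto

text \<open>If \<open>f x = f l\<close> with \<open>l\<close> in \<open>L\<close>, then
  \<open>x\<close> differs from \<open>l\<close> by an element of the kernel, which lies in
  \<open>L\<close>.\<close>

lemma preimage_image:
  assumes L: "submodule L R M" and ker: "\<And>x. \<lbrakk>x \<in> carrier M; f x = \<zero>\<^bsub>N\<^esub>\<rbrakk> \<Longrightarrow> x \<in> L"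
  shows "{x \<in> carrier M. f x \<in> f ` L} = L"
proof (intro equalityI subsetI)
  fix x assume "x \<in> {x \<in> carrier M. f x \<in> f ` L}"
  then obtain l where x: "x \<in> carrier M" and l: "l \<in> L" "f x = f l" by auto
  have lM: "l \<in> carrier M" using l submoduleD(1)[OF L] by auto
  have "x \<oplus>\<^bsub>M\<^esub> \<ominus>\<^bsub>M\<^esub> l \<in> L"
    using x l lM by (intro ker) (auto simp: N.r_neg)
  then have "(x \<oplus>\<^bsub>M\<^esub> \<ominus>\<^bsub>M\<^esub> l) \<oplus>\<^bsub>M\<^esub> l \<in> L"
    using l(1) by (rule submoduleD(3)[OF L])
  then show "x \<in> L" using x lM by (simp add: M.a_assoc M.l_neg)
qed (use submoduleD(1)[OF L] in auto)

text \<open>A submodule between the preimage of \<open>K\<close> and \<open>M\<close> is determined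
  by its image, which lies between \<open>K\<close> and \<open>N\<close>.\<close>

lemma maximal_submodule_preimage:
  assumes "maximal_submodule K R N"
  shows "maximal_submodule {x \<in> carrier M. f x \<in> K} R M"
proof -
  let ?P = "{x \<in> carrier M. f x \<in> K}"
  have K: "submodule K R N" "K \<noteq> carrier N"
    and max: "\<And>L. \<lbrakk>submodule L R N; K \<subseteq> L\<rbrakk> \<Longrightarrow> L = K \<or> L = carrier N"
    using assms by (auto simp: maximal_submodule_def)
  note KD = submoduleD[OF K(1)]
  \<comment> \<open>Otherwise surjectivity would make \<open>K\<close> all of
    \<open>N\<close>.\<close>
  have "?P \<noteq> carrier M"
    using K(2) image_preimage[OF KD(1)] surj by auto
  moreover have "L = ?P \<or> L = carrier M" if L: "submodule L R M" "?P \<subseteq> L" for L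
  proof -
    have "K \<subseteq> f ` L" using image_preimage[OF KD(1)] L(2) by blast
    then have "f ` L = K \<or> f ` L = carrier N"
      using max submodule_image[OF L(1)] by blast
    \<comment> \<open>Since \<open>K\<close> contains zero, \<open>?P\<close> contains the kernel,
      and hence so does \<open>L\<close>.\<close>
    moreover have "{x \<in> carrier M. f x \<in> f ` L} = L"
      using L KD(2) by (intro preimage_image) auto
    ultimately show ?thesis by auto
  qed
  ultimately show ?thesis
    using submodule_preimage[OF K(1)] by (auto simp: maximal_submodule_def)
qed

text \<open>If \<open>L\<close> meets the preimage trivially, its image meets \<open>K\<close>
  trivially and so vanishes. Then \<open>L\<close> lies in the kernel, hence in the preimage, and
  equals the trivial intersection.\<close>

lemma essential_submodule_preimage:
  assumes "essential_submodule K R N"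
  shows "essential_submodule {x \<in> carrier M. f x \<in> K} R M"
proof -
  let ?P = "{x \<in> carrier M. f x \<in> K}"
  have K: "submodule K R N"
    and ess: "\<And>L. \<lbrakk>submodule L R N; L \<inter> K = {\<zero>\<^bsub>N\<^esub>}\<rbrakk> \<Longrightarrow> L = {\<zero>\<^bsub>N\<^esub>}"
    using assms by (auto simp: essential_submodule_def)
  have "L = {\<zero>\<^bsub>M\<^esub>}" if L: "submodule L R M" and int: "L \<inter> ?P = {\<zero>\<^bsub>M\<^esub>}" for L
  proof -
    have LM: "L \<subseteq> carrier M" by (rule submoduleD(1)[OF L])
    then have "f ` L \<inter> K = f ` (L \<inter> ?P)" by auto
    also have "\<dots> = {\<zero>\<^bsub>N\<^esub>}" unfolding int by simp
    finally have "f ` L = {\<zero>\<^bsub>N\<^esub>}"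
      by (rule ess[OF submodule_image[OF L]])
    then have "f ` L \<subseteq> K" using submoduleD(2)[OF K] by simp
    then have "L \<subseteq> ?P" using LM by blast
    then show ?thesis using int by blast
  qed
  then show ?thesis
    using submodule_preimage[OF K] by (auto simp: essential_submodule_def)
qed

lemma image_Rad_g: "f ` Rad_g R M \<subseteq> Rad_g R N"
proof (cases "\<exists>K. maximal_submodule K R N \<and> essential_submodule K R N")
  case True
  have "f x \<in> K" if x: "x \<in> Rad_g R M"
    and K: "maximal_submodule K R N" "essential_submodule K R N" for x K
  proof -
    have "maximal_submodule {x \<in> carrier M. f x \<in> K} R M \<and>
        essential_submodule {x \<in> carrier M. f x \<in> K} R M"
      using K maximal_submodule_preimage essential_submodule_preimage by blast
    \<comment> \<open>The preimage also shows that \<open>M\<close> has an essential maximal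
      submodule, so \<open>Rad_g R M\<close> is the intersection and not the default value.\<close>
    with x have "x \<in> {x \<in> carrier M. f x \<in> K}"
      unfolding Rad_g_def by (auto split: if_splits)
    then show ?thesis by simp
  qed
  then have "f ` Rad_g R M \<subseteq> \<Inter>{K. maximal_submodule K R N \<and> essential_submodule K R N}"
    by blast
  with True show ?thesis by (simp add: Rad_g_def[of R N])
next
  \<comment> \<open>Here \<open>Rad_g R N\<close> takes its default value, the whole
    carrier.\<close>
  case False
  have "Rad_g R M \<subseteq> carrier M"
    by (auto simp: Rad_g_def maximal_submodule_def dest: submoduleD(1))
  then have "f ` Rad_g R M \<subseteq> carrier N" by auto
  with False show ?thesis by (simp only: Rad_g_def[of R N] if_False)
qed

end

lemma (in left_module_epi) g_radical_supplemented_image: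
  assumes "g_radical_supplemented R M"
  shows "g_radical_supplemented R N"
  unfolding g_radical_supplemented_def
proof (intro allI impI)
  fix U assume U: "submodule U R N"
  let ?P = "{x \<in> carrier M. f x \<in> U}"
  obtain V where V: "submodule V R M" "carrier M = ?P <+>\<^bsub>M\<^esub> V"
    and int: "?P \<inter> V \<subseteq> Rad_g R (M\<lparr>carrier := V\<rparr>)"
    using assms submodule_preimage[OF U]
    by (auto simp: g_radical_supplemented_def g_radical_supplement_def)
  have VM: "V \<subseteq> carrier M" by (rule submoduleD(1)[OF V(1)])
  have fV: "submodule (f ` V) R N" by (rule submodule_image[OF V(1)])
  \<comment> \<open>The radical condition concerns \<open>V\<close> as a module of its own, so
    \<open>image_Rad_g\<close> is needed for the restriction of \<open>f\<close> to
    \<open>V\<close>.\<close>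
  interpret V: left_module_epi R "M\<lparr>carrier := V\<rparr>" "N\<lparr>carrier := f ` V\<rparr>" f
    using VM by (intro left_module_epi.intro left_module_epi_axioms.intro
        M.submodule_is_left_module[OF V(1)] N.submodule_is_left_module[OF fV]
        left_module_hom_restrict[OF hom]) auto
  have "f ` carrier M = U <+>\<^bsub>N\<^esub> f ` V"
  proof -
    have "f ` (?P <+>\<^bsub>M\<^esub> V) = f ` ?P <+>\<^bsub>N\<^esub> f ` V"
      using VM by (force simp: set_add_def' subset_iff)
    then show ?thesis
      using V(2) image_preimage[OF submoduleD(1)[OF U]] by simp
  qed
  \<comment> \<open>If \<open>f v\<close> lies in \<open>U\<close> for some \<open>v\<close> in
    \<open>V\<close>, then \<open>v\<close> itself lies in \<open>?P\<close>.\<close>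
  moreover have "U \<inter> f ` V \<subseteq> f ` (?P \<inter> V)" using VM by auto
  then have "U \<inter> f ` V \<subseteq> Rad_g R (N\<lparr>carrier := f ` V\<rparr>)"
    using int V.image_Rad_g by blast
  ultimately show "\<exists>V. g_radical_supplement V U R N"
    using U fV surj by (auto simp: g_radical_supplement_def)
qed

theorem corollary2p8:
  fixes R :: "('r, 'k) ring_scheme"
    and M :: "('r, 'a, 'm) module_scheme"
    and N :: "('r, 'b, 'n) module_scheme"
    and f :: "'a \<Rightarrow> 'b"
  assumes "ring R"
    and "left_module R M"
    and "g_radical_supplemented R M"
    and "left_module R N"
    and "f \<in> left_module_hom R M N"
  shows "g_radical_supplemented R (N\<lparr>carrier := f ` carrier M\<rparr>)"
proof -
  have "left_module R (N\<lparr>carrier := f ` carrier M\<rparr>)"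
    using assms by (intro left_module.submodule_is_left_module image_submodule)
  moreover have "f \<in> left_module_hom R M (N\<lparr>carrier := f ` carrier M\<rparr>)"
    using left_module_hom_restrict[OF assms(5) subset_refl subset_refl] by simp
  \<comment> \<open>With its image as target, \<open>f\<close> is surjective.\<close>
  ultimately interpret left_module_epi R M "N\<lparr>carrier := f ` carrier M\<rparr>" f
    using assms by (intro left_module_epi.intro left_module_epi_axioms.intro) auto
  show ?thesis
    using assms(3) by (rule g_radical_supplemented_image)
qed

end
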